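(* Let $k\ge 2$ and let $n_1,\dots,n_k$ be positive integers with $\sum_{i=1}^k n_i=n$. Let $G=K_{n_1,n_2,\dots,n_k}$ be the complete $k$-partite graph with parts of sizes $n_1,\dots,n_k$. Then $G$ is determined by its D-spectrum: if $G'$ is any simple connected graph such that $D(G')$ and $D(G)$ have the same multiset of eigenvalues, then $G'\cong G$.
   Context: All graphs are simple, undirected and connected. For a connected graph $G$ on $n$ vertices, the distance matrix $D(G)=(a_{uv})_{n\times n}$ has $a_{uv}=d_G(u,v)$, the length of a shortest path between $u$ and $v$. The D-spectrum of $G$ is the multiset of eigenvalues of $D(G)$ (with multiplicities). Two graphs are D-cospectral if their D-spectra coincide; a graph $G$ is determined by its D-spectrum if every graph D-cospectral with $G$ is isomorphic to $G$. *)

theory Defs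
  imports
    "Graph_Theory.Graph_Theory"
    "Jordan_Normal_Form.Char_Poly"
    "HOL-Computational_Algebra.Fundamental_Theorem_Algebra"
begin

(* A finite simple undirected graph is a pair_graph of the Graph_Theory entry: a finite symmetric
   loop-free digraph whose arcs are pairs of vertices, so that an edge {u,v} is the pair of arcs
   (u,v), (v,u). *)

definition graph_dist :: "'a pair_pre_digraph \<Rightarrow> 'a \<Rightarrow> 'a \<Rightarrow> nat" where
  "graph_dist G u v =
     (LEAST d. \<exists>p. pre_digraph.apath (with_proj G) u p v \<and> length p = d)"

definition distance_matrix :: "'a pair_pre_digraph \<Rightarrow> 'a list \<Rightarrow> real mat" where
  "distance_matrix G vs =
     mat (length vs) (length vs) (\<lambda>(i, j). real (graph_dist G (vs ! i) (vs ! j)))"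

(* An arbitrary enumeration of the vertices; another choice conjugates the distance matrix by a
   permutation matrix and so leaves its characteristic polynomial unchanged. *)
definition vertex_enum :: "'a pair_pre_digraph \<Rightarrow> 'a list" where
  "vertex_enum G = (SOME vs. distinct vs \<and> set vs = pverts G)"

(* The roots are taken over the complex numbers, so that the multiset contains all eigenvalues
   without appeal to the fact that those of a real symmetric matrix are real. Algebraic and
   geometric multiplicities agree here, again by symmetry. *)
definition D_spectrum :: "'a pair_pre_digraph \<Rightarrow> complex multiset" where
  "D_spectrum G =
     proots (char_poly (map_mat complex_of_real (distance_matrix G (vertex_enum G))))"

(* The vertex (i, j) is the j-th vertex of the i-th part, and the parts are indexed by 1, ..., k. *)
definition complete_multipartite :: "nat \<Rightarrow> (nat \<Rightarrow> nat) \<Rightarrow> (nat \<times> nat) pair_pre_digraph" where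
  "complete_multipartite k ns =
     (let V = (SIGMA i:{1..k}. {1..ns i})
      in \<lparr> pverts = V, parcs = {(u, v). u \<in> V \<and> v \<in> V \<and> fst u \<noteq> fst v} \<rparr>)"

lemma vertex_enum:
  assumes "pair_graph G"
  shows "distinct (vertex_enum G)" and "set (vertex_enum G) = pverts G"
proof -
  interpret pair_graph G by fact
  have "\<exists>vs. distinct vs \<and> set vs = pverts G"
    using finite_distinct_list[OF pair_finite_verts] by blast
  from someI_ex[OF this] show "distinct (vertex_enum G)" "set (vertex_enum G) = pverts G"
    by (simp_all add: vertex_enum_def)
qed

lemma size_D_spectrum:
  assumes "pair_graph G"
  shows "size (D_spectrum G) = card (pverts G)"
proof -
  let ?A = "map_mat complex_of_real (distance_matrix G (vertex_enum G))"
  let ?n = "length (vertex_enum G)"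
  have "?A \<in> carrier_mat ?n ?n"
    by (simp add: distance_matrix_def)
  then have "degree (char_poly ?A) = ?n"
    by (rule degree_monic_char_poly[THEN conjunct1])
  then show ?thesis
    using vertex_enum[OF assms]
    by (metis D_spectrum_def distinct_card size_proots_complex)
qed

lemma pair_graph_complete_multipartite: "pair_graph (complete_multipartite k ns)"
proof -
  let ?G = "complete_multipartite k ns"
  have fin: "finite (pverts ?G)" and sub: "parcs ?G \<subseteq> pverts ?G \<times> pverts ?G"
    by (auto simp: complete_multipartite_def Let_def)
  then have "finite (parcs ?G)"
    by (meson finite_SigmaI finite_subset)
  moreover have "sym (parcs ?G)"
    by (auto simp: complete_multipartite_def Let_def sym_def)
  moreover have "fst e \<noteq> snd e" if "e \<in> parcs ?G" for e
    using that by (auto simp: complete_multipartite_def Let_def)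
  ultimately show ?thesis
    using fin sub by unfold_locales (auto simp: symmetric_def)
qed

lemma card_verts_complete_multipartite:
  "card (pverts (complete_multipartite k ns)) = (\<Sum>i=1..k. ns i)"
  by (simp add: complete_multipartite_def Let_def)

lemma connected_complete_multipartite:
  assumes "2 \<le> k" and "\<forall>i\<in>{1..k}. 0 < ns i"
  shows "Digraph_Component.connected (with_proj (complete_multipartite k ns))"
proof -
  let ?G = "complete_multipartite k ns"
  interpret pair_graph ?G by (rule pair_graph_complete_multipartite)
  have wf: "wf_digraph (with_proj ?G)" by unfold_locales
  have adj: "u \<rightarrow>\<^bsub>with_proj ?G\<^esub> v" if "u \<in> pverts ?G" "v \<in> pverts ?G" "fst u \<noteq> fst v" for u v
    using that by (simp add: complete_multipartite_def Let_def)
  have other: "\<exists>w\<in>pverts ?G. fst w \<noteq> i" for i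
  proof
    define i' :: nat where "i' = (if i = 1 then 2 else 1)"
    have "i' \<in> {1..k}" "i' \<noteq> i"
      using assms(1) by (simp_all add: i'_def)
    moreover from this assms(2) have "0 < ns i'" by blast
    ultimately show "(i', 1) \<in> pverts ?G" "fst (i', 1::nat) \<noteq> i"
      by (simp_all add: complete_multipartite_def Let_def)
  qed
  have reach: "u \<rightarrow>\<^sup>*\<^bsub>with_proj ?G\<^esub> v" if uv: "u \<in> pverts ?G" "v \<in> pverts ?G" for u v
  proof (cases "fst u = fst v")
    case True
    obtain w where w: "w \<in> pverts ?G" "fst w \<noteq> fst u" using other by blast
    have "u \<rightarrow>\<^bsub>with_proj ?G\<^esub> w" using adj[OF uv(1) w(1)] w(2) by metis
    moreover have "w \<rightarrow>\<^bsub>with_proj ?G\<^esub> v" using adj[OF w(1) uv(2)] w(2) True by metis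
    ultimately show ?thesis
      by (metis wf_digraph.adj_reachable_trans[OF wf] wf_digraph.reachable_adjI[OF wf])
  next
    case False
    then show ?thesis using adj[OF uv] by (metis wf_digraph.reachable_adjI[OF wf])
  qed
  have "pverts ?G \<noteq> {}" using other by blast
  then show ?thesis
    using reach
    by (intro wf_digraph.connectedI[OF wf])
      (simp_all only: wf_digraph.reachable_mk_symmetric_eq[OF wf sym_arcs] with_proj_simps not_False_eq_True)
qed

end

theory Submission
  imports Defs
begin

text \<open>
  For a complete multipartite graph on n vertices, D + 2I has entry 2 inside a part and 1 between
  parts, and its characteristic polynomial is (n + 1) q - X q', where q is the product of the
  X - m over the part sizes m, times the power of X that makes the degree n. Hence the spectrum
  determines q, which in turn determines the part sizes, and it has no element below -2. So if D' is
  the distance matrix of a cospectral graph, D' + 2I is positive semidefinite. Testing it on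
  (1, -1) excludes distances of at least 3, and testing it on (1, -2, 1) excludes a vertex
  nonadjacent to both ends of an edge: nonadjacency is transitive, and the cospectral graph is
  complete multipartite too.
\<close>

section \<open>Determinants and quadratic forms\<close>

lemma poly_char_poly:
  fixes A :: "'a :: comm_ring_1 mat"
  assumes A: "A \<in> carrier_mat n n"
  shows "poly (char_poly A) x = det (x \<cdot>\<^sub>m 1\<^sub>m n - A)"
proof -
  have hom: "comm_ring_hom (\<lambda>p :: 'a poly. poly p x)" by unfold_locales auto
  have "poly (char_poly A) x = det (map_mat (\<lambda>p. poly p x) (char_poly_matrix A))"
    by (simp add: char_poly_def comm_ring_hom.hom_det[OF hom])
  also have "map_mat (\<lambda>p. poly p x) (char_poly_matrix A) = x \<cdot>\<^sub>m 1\<^sub>m n - A"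
    using A by (intro eq_matI) (auto simp: char_poly_matrix_def)
  finally show ?thesis .
qed

text \<open>Sylvester's determinant identity. Multiplying the block matrix \<open>?F\<close> on the
  right by a block triangular matrix of determinant 1 clears either its lower left block (by
  \<open>?L\<close>) or its upper right block (by \<open>?U\<close>), and \<open>det ?F\<close> is
  read off in both ways.\<close>

lemma det_one_add_mult_commute:
  fixes A :: "'a :: idom mat"
  assumes A: "A \<in> carrier_mat n m" and B: "B \<in> carrier_mat m n"
  shows "det (1\<^sub>m n + A * B) = det (1\<^sub>m m + B * A)"
proof -
  let ?F = "four_block_mat (1\<^sub>m n) (- A) B (1\<^sub>m m)"
  let ?L = "four_block_mat (1\<^sub>m n) (0\<^sub>m n m) (- B) (1\<^sub>m m)"
  let ?U = "four_block_mat (1\<^sub>m n) A (0\<^sub>m m n) (1\<^sub>m m)"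
  have F: "?F \<in> carrier_mat (n + m) (n + m)" and L: "?L \<in> carrier_mat (n + m) (n + m)"
    and U: "?U \<in> carrier_mat (n + m) (n + m)"
    by auto
  have "?F * ?L = four_block_mat (1\<^sub>m n + A * B) (- A) (0\<^sub>m m n) (1\<^sub>m m)"
    using A B by (subst mult_four_block_mat[of _ n n _ m _ m]) (auto intro!: cong_four_block_mat)
  moreover have "det (four_block_mat (1\<^sub>m n + A * B) (- A) (0\<^sub>m m n) (1\<^sub>m m)) = det (1\<^sub>m n + A * B)"
    using A B by (subst det_four_block_mat_lower_left_zero[of _ n _ m]) auto
  moreover have "det ?L = 1"
    using B by (subst det_four_block_mat_upper_right_zero[of _ n _ m]) auto
  ultimately have 1: "det ?F = det (1\<^sub>m n + A * B)"
    using det_mult[OF F L] by simp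
  have "?F * ?U = four_block_mat (1\<^sub>m n) (0\<^sub>m n m) B (1\<^sub>m m + B * A)"
    using A B by (subst mult_four_block_mat[of _ n n _ m _ m])
      (auto intro!: cong_four_block_mat simp: comm_add_mat[of _ m m])
  moreover have "det (four_block_mat (1\<^sub>m n) (0\<^sub>m n m) B (1\<^sub>m m + B * A)) = det (1\<^sub>m m + B * A)"
    using A B by (subst det_four_block_mat_upper_right_zero[of _ n _ m]) auto
  moreover have "det ?U = 1"
    using A by (subst det_four_block_mat_lower_left_zero[of _ n _ m]) auto
  ultimately have 2: "det ?F = det (1\<^sub>m m + B * A)"
    using det_mult[OF F U] by simp
  from 1 2 show ?thesis by simp
qed

text \<open>The matrix determinant lemma: for a rank one perturbation of the identity, Sylvester's
  identity leaves a 1 by 1 determinant.\<close>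

lemma det_one_add_outer:
  fixes u v :: "nat \<Rightarrow> 'a :: idom"
  shows "det (mat n n (\<lambda>(i, j). (if i = j then 1 else 0) + u i * v j)) = 1 + (\<Sum>i<n. u i * v i)"
proof -
  let ?A = "mat n 1 (\<lambda>(i, j). u i)" and ?B = "mat 1 n (\<lambda>(i, j). v j)"
  have "mat n n (\<lambda>(i, j). (if i = j then 1 else 0) + u i * v j) = 1\<^sub>m n + ?A * ?B"
    by (intro eq_matI) (auto simp: scalar_prod_def)
  also have "det \<dots> = det (1\<^sub>m 1 + ?B * ?A)"
    by (rule det_one_add_mult_commute[of _ n 1]) auto
  also have "\<dots> = 1 + (\<Sum>i<n. u i * v i)"
    by (subst det_single) (auto simp: scalar_prod_def lessThan_atLeast0 mult.commute)
  finally show ?thesis .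
qed

lemma det_mat_diag: "det (mat_diag n d) = (\<Prod>i<n. d i)"
  by (subst det_upper_triangular[of _ n])
     (auto simp: mat_diag_def diag_mat_def prod.list_conv_set_nth lessThan_atLeast0)

text \<open>By the arithmetic-geometric mean inequality each |v_i v_j| is at most v . v. The
  constant is crude, but only its independence of \<open>v\<close> matters below.\<close>

lemma abs_quadratic_form_le:
  fixes A :: "real mat"
  assumes A: "A \<in> carrier_mat n n" and v: "v \<in> carrier_vec n"
  shows "\<bar>v \<bullet> (A *\<^sub>v v)\<bar> \<le> (\<Sum>i<n. \<Sum>j<n. \<bar>A $$ (i, j)\<bar>) * (v \<bullet> v)"
proof -
  have sq: "v $ i * v $ i \<le> v \<bullet> v" if "i < n" for i
    using that v unfolding scalar_prod_def
    by (intro member_le_sum[of i _ "\<lambda>i. v $ i * v $ i"]) auto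
  have prod: "\<bar>v $ i\<bar> * \<bar>v $ j\<bar> \<le> v \<bullet> v" if "i < n" "j < n" for i j
  proof -
    have "0 \<le> (\<bar>v $ i\<bar> - \<bar>v $ j\<bar>) * (\<bar>v $ i\<bar> - \<bar>v $ j\<bar>)" by simp
    then have "2 * (\<bar>v $ i\<bar> * \<bar>v $ j\<bar>) \<le> v $ i * v $ i + v $ j * v $ j"
      by (simp add: algebra_simps)
    with sq[OF that(1)] sq[OF that(2)] show ?thesis by linarith
  qed
  have "v \<bullet> (A *\<^sub>v v) = (\<Sum>i<n. \<Sum>j<n. A $$ (i, j) * (v $ i * v $ j))"
    using A v by (auto simp: scalar_prod_def lessThan_atLeast0 sum_distrib_left mult_ac intro!: sum.cong)
  also have "\<bar>\<dots>\<bar> \<le> (\<Sum>i<n. \<Sum>j<n. \<bar>A $$ (i, j) * (v $ i * v $ j)\<bar>)"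
    by (intro order.trans[OF sum_abs] sum_mono sum_abs)
  also have "\<dots> \<le> (\<Sum>i<n. \<Sum>j<n. \<bar>A $$ (i, j)\<bar> * (v \<bullet> v))"
    using prod by (intro sum_mono) (auto simp: abs_mult intro!: mult_left_mono)
  finally show ?thesis by (simp add: sum_distrib_right)
qed

text \<open>Write Q for the form of \<open>A\<close> and w for the inverse of \<open>A\<close>
  applied to v. Then Q(v - s w) = Q(v) - 2 s (v . v) + s^2 (v . w), where v . w is at most C (v .
  v). Nonnegativity of this value at s = 1/C is the claim with constant 1/C.\<close>

lemma psd_nonsingular_imp_coercive:
  fixes A :: "real mat"
  assumes A: "A \<in> carrier_mat n n" and sym: "transpose_mat A = A" and det: "det A \<noteq> 0"
    and psd: "\<And>v. v \<in> carrier_vec n \<Longrightarrow> 0 \<le> v \<bullet> (A *\<^sub>v v)"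
  obtains c where "c > 0" and "\<And>v. v \<in> carrier_vec n \<Longrightarrow> c * (v \<bullet> v) \<le> v \<bullet> (A *\<^sub>v v)"
proof -
  have "A \<in> Units (ring_mat TYPE(real) n ())"
    by (rule det_non_zero_imp_unit[OF A det])
  then obtain N where N: "N \<in> carrier_mat n n" and AN: "A * N = 1\<^sub>m n"
    by (auto simp: Units_def ring_mat_def)
  \<comment> \<open>The summand 1 keeps \<open>C\<close> positive for n = 0 as well, where the sum
    is empty.\<close>
  define C where "C = 1 + (\<Sum>i<n. \<Sum>j<n. \<bar>N $$ (i, j)\<bar>)"
  have C: "C > 0"
    unfolding C_def by (intro add_pos_nonneg sum_nonneg) auto
  show thesis
  proof
    show "1 / C > 0" using C by simp
  next
    fix v :: "real vec" assume v: "v \<in> carrier_vec n"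
    define w where "w = N *\<^sub>v v"
    have w: "w \<in> carrier_vec n" using N v by (simp add: w_def)
    have Aw: "A *\<^sub>v w = v"
      using A N v AN by (simp add: w_def flip: assoc_mult_mat_vec)
    have "v \<bullet> v \<ge> 0"
      by (auto simp: scalar_prod_def intro!: sum_nonneg)
    moreover have "\<bar>v \<bullet> w\<bar> \<le> (C - 1) * (v \<bullet> v)"
      using abs_quadratic_form_le[OF N v] by (simp add: w_def C_def)
    ultimately have vw: "v \<bullet> w \<le> C * (v \<bullet> v)"
      by (simp add: algebra_simps)
    have wAv: "w \<bullet> (A *\<^sub>v v) = v \<bullet> v"
      using transpose_vec_mult_scalar[OF A v w] by (simp add: sym Aw)
    \<comment> \<open>This value maximises 2 s - C s^2, the coefficient of v . v that remains in the
      lower bound.\<close>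
    let ?s = "1 / C"
    let ?x = "v - ?s \<cdot>\<^sub>v w"
    have Ax: "A *\<^sub>v ?x = A *\<^sub>v v - ?s \<cdot>\<^sub>v v"
      using A v w Aw by (simp add: mult_minus_distrib_mat_vec mult_mat_vec)
    have "0 \<le> ?x \<bullet> (A *\<^sub>v ?x)"
      using v w by (intro psd) auto
    also have "\<dots> = v \<bullet> (A *\<^sub>v v) - ?s * (v \<bullet> v) - ?s * (w \<bullet> (A *\<^sub>v v)) + ?s * ?s * (w \<bullet> v)"
      unfolding Ax using A v w
      by (simp add: minus_scalar_prod_distrib[of _ n] scalar_prod_minus_distrib[of _ n] algebra_simps)
    also have "w \<bullet> v = v \<bullet> w" using v w by (rule comm_scalar_prod[rotated])
    finally have "0 \<le> v \<bullet> (A *\<^sub>v v) - 2 * ?s * (v \<bullet> v) + ?s * ?s * (v \<bullet> w)"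
      by (simp add: wAv)
    moreover have "?s * ?s * (v \<bullet> w) \<le> ?s * ?s * (C * (v \<bullet> v))"
      using vw by (intro mult_left_mono) auto
    moreover have "?s * ?s * (C * (v \<bullet> v)) = ?s * (v \<bullet> v)"
      using C by simp
    ultimately show "?s * (v \<bullet> v) \<le> v \<bullet> (A *\<^sub>v v)" by linarith
  qed
qed

text \<open>
  The largest b for which A - bI is positive semidefinite is an eigenvalue, since otherwise A - bI
  would be coercive and b could be increased.
\<close>

lemma quadratic_form_ge_if_no_char_poly_root_below:
  fixes A :: "real mat"
  assumes A: "A \<in> carrier_mat n n" and sym: "transpose_mat A = A"
    and root: "\<And>x. x < a \<Longrightarrow> poly (char_poly A) x \<noteq> 0"
    and v: "v \<in> carrier_vec n"
  shows "a * (v \<bullet> v) \<le> v \<bullet> (A *\<^sub>v v)"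
proof -
  define S where "S = {b. \<forall>u\<in>carrier_vec n. b * (u \<bullet> u) \<le> u \<bullet> (A *\<^sub>v u)}"
  have nn: "0 \<le> u \<bullet> u" for u :: "real vec"
    by (auto simp: scalar_prod_def intro!: sum_nonneg)
  have down: "b \<in> S" if "b' \<in> S" "b \<le> b'" for b b'
    using that mult_right_mono[OF that(2) nn] unfolding S_def by (blast intro: order.trans)
  have "- (\<Sum>i<n. \<Sum>j<n. \<bar>A $$ (i, j)\<bar>) \<in> S"
    using abs_quadratic_form_le[OF A] by (force simp: S_def)
  then have ne: "S \<noteq> {}" by blast
  have "a \<in> S"
  proof (rule ccontr)
    assume a: "a \<notin> S"
    then have le: "s \<le> a" if "s \<in> S" for s
      using down[OF that, of a] by linarith
    then have bdd: "bdd_above S" by (auto simp: bdd_above_def)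
    define b where "b = Sup S"
    \<comment> \<open>The supremum is attained: for each \<open>u\<close> with u . u > 0 the
      condition on b is a non-strict upper bound, and for u . u = 0 both sides vanish.\<close>
    have bS: "b \<in> S"
      unfolding S_def
    proof (intro CollectI ballI)
      fix u :: "real vec" assume u: "u \<in> carrier_vec n"
      show "b * (u \<bullet> u) \<le> u \<bullet> (A *\<^sub>v u)"
      proof (cases "u \<bullet> u = 0")
        case True
        then show ?thesis using abs_quadratic_form_le[OF A u] by simp
      next
        case False
        then have pos: "u \<bullet> u > 0" using nn[of u] by linarith
        have "s \<le> (u \<bullet> (A *\<^sub>v u)) / (u \<bullet> u)" if "s \<in> S" for s
          using that u unfolding S_def pos_le_divide_eq[OF pos] by blast
        then have "b \<le> (u \<bullet> (A *\<^sub>v u)) / (u \<bullet> u)"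
          unfolding b_def by (rule cSup_least[OF ne])
        then show ?thesis unfolding pos_le_divide_eq[OF pos] .
      qed
    qed
    have "b < a" using le[OF bS] bS a by (cases "a = b") auto
    define B where "B = A - b \<cdot>\<^sub>m 1\<^sub>m n"
    have B: "B \<in> carrier_mat n n" using A unfolding B_def by (intro minus_carrier_mat) auto
    have QB: "u \<bullet> (B *\<^sub>v u) = u \<bullet> (A *\<^sub>v u) - b * (u \<bullet> u)" if u: "u \<in> carrier_vec n" for u
    proof -
      have "B *\<^sub>v u = A *\<^sub>v u - b \<cdot>\<^sub>v u"
        unfolding B_def using A u
        by (subst minus_mult_distrib_mat_vec[of _ n n]) auto
      then show ?thesis using A u by (simp add: scalar_prod_minus_distrib[of _ n])
    qed
    \<comment> \<open>Up to sign, det B is the characteristic polynomial at b, and b < a is not a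
      root.\<close>
    have "B = - (b \<cdot>\<^sub>m 1\<^sub>m n - A)"
      using A by (intro eq_matI) (auto simp: B_def)
    moreover have "det (b \<cdot>\<^sub>m 1\<^sub>m n - A) \<noteq> 0"
      using root[OF \<open>b < a\<close>] by (simp add: poly_char_poly[OF A])
    ultimately have "det B \<noteq> 0"
      using A by (metis det_0_negate minus_carrier_mat)
    moreover have "transpose_mat B = B"
      using sym A unfolding B_def by (subst transpose_minus[of _ n n]) auto
    moreover have "0 \<le> u \<bullet> (B *\<^sub>v u)" if "u \<in> carrier_vec n" for u
      using bS that unfolding QB[OF that] S_def by simp
    ultimately obtain c where c: "c > 0" "\<And>u. u \<in> carrier_vec n \<Longrightarrow> c * (u \<bullet> u) \<le> u \<bullet> (B *\<^sub>v u)"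
      using psd_nonsingular_imp_coercive[OF B] by metis
    have "b + c \<in> S"
      unfolding S_def
    proof (intro CollectI ballI)
      fix u :: "real vec" assume u: "u \<in> carrier_vec n"
      show "(b + c) * (u \<bullet> u) \<le> u \<bullet> (A *\<^sub>v u)"
        using c(2)[OF u] unfolding QB[OF u] by (simp add: distrib_right)
    qed
    then have "b + c \<le> b" unfolding b_def by (rule cSup_upper[OF _ bdd])
    with c(1) show False by simp
  qed
  then show ?thesis using v by (simp add: S_def)
qed

text \<open>For test vectors supported on two or three vertices, the form becomes a double sum short
  enough to be evaluated term by term.\<close>

lemma quadratic_form_on_support:
  fixes A :: "'a :: comm_ring_1 mat"
  assumes A: "A \<in> carrier_mat n n" and S: "S \<subseteq> {..<n}"
  shows "vec n (\<lambda>i. if i \<in> S then x i else 0) \<bullet> (A *\<^sub>v vec n (\<lambda>i. if i \<in> S then x i else 0)) =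
    (\<Sum>i\<in>S. \<Sum>j\<in>S. x i * A $$ (i, j) * x j)"
proof -
  let ?v = "vec n (\<lambda>i. if i \<in> S then x i else 0)"
  have "(A *\<^sub>v ?v) $ i = (\<Sum>j\<in>S. A $$ (i, j) * x j)" if "i < n" for i
  proof -
    have "(A *\<^sub>v ?v) $ i = (\<Sum>j<n. A $$ (i, j) * (if j \<in> S then x j else 0))"
      using A that by (simp add: scalar_prod_def lessThan_atLeast0)
    also have "\<dots> = (\<Sum>j\<in>S. A $$ (i, j) * x j)"
      using S by (intro sum.mono_neutral_cong_right) auto
    finally show ?thesis .
  qed
  then have "?v \<bullet> (A *\<^sub>v ?v) = (\<Sum>i<n. (if i \<in> S then x i else 0) * (\<Sum>j\<in>S. A $$ (i, j) * x j))"
    using A by (simp add: scalar_prod_def lessThan_atLeast0)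
  also have "\<dots> = (\<Sum>i\<in>S. x i * (\<Sum>j\<in>S. A $$ (i, j) * x j))"
    using S by (intro sum.mono_neutral_cong_right) auto
  finally show ?thesis by (simp add: sum_distrib_left mult.assoc)
qed

lemma scalar_prod_on_support:
  fixes x :: "nat \<Rightarrow> 'a :: comm_ring_1"
  assumes S: "S \<subseteq> {..<n}"
  shows "vec n (\<lambda>i. if i \<in> S then x i else 0) \<bullet> vec n (\<lambda>i. if i \<in> S then x i else 0) = (\<Sum>i\<in>S. x i * x i)"
proof -
  let ?v = "vec n (\<lambda>i. if i \<in> S then x i else 0)"
  have "?v \<bullet> ?v = (\<Sum>i<n. (if i \<in> S then x i else 0) * (if i \<in> S then x i else 0))"
    by (simp add: scalar_prod_def lessThan_atLeast0)
  also have "\<dots> = (\<Sum>i\<in>S. x i * x i)"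
    using S by (intro sum.mono_neutral_cong_right) auto
  finally show ?thesis .
qed

section \<open>The spectrum of a complete multipartite graph\<close>

text \<open>
  Parts are labelled by numbers below n and may be empty: the empty ones contribute the factors X
  that raise the degree of q to n.
\<close>

definition class_size :: "(nat \<Rightarrow> nat) \<Rightarrow> nat \<Rightarrow> nat \<Rightarrow> nat" where
  "class_size c n p = card {i. i < n \<and> c i = p}"

definition multipartite_dist_mat :: "(nat \<Rightarrow> nat) \<Rightarrow> nat \<Rightarrow> real mat" where
  "multipartite_dist_mat c n =
     mat n n (\<lambda>(i, j). if i = j then 0 else if c i = c j then 2 else 1)"

lemma multipartite_dist_mat_carrier [simp]: "multipartite_dist_mat c n \<in> carrier_mat n n"
  by (simp add: multipartite_dist_mat_def)

text \<open>With E the 0/1 incidence matrix of vertices and labels and J the all-ones matrix, D + 2I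
  = E (J + I) E^T. Sylvester's identity moves the determinant to the labels, where E^T E is the
  diagonal matrix M of class sizes. What remains is a diagonal matrix times a rank one perturbation
  of the identity. The shift to y - 2 makes y the spectral variable of D + 2I.\<close>

lemma poly_char_poly_multipartite:
  fixes y :: real
  assumes c: "\<And>i. i < n \<Longrightarrow> c i < n"
    and y: "y \<noteq> 0" "\<And>p. p < n \<Longrightarrow> y \<noteq> real (class_size c n p)"
  shows "poly (char_poly (multipartite_dist_mat c n)) (y - 2) =
    (\<Prod>p<n. y - real (class_size c n p)) * (1 - (\<Sum>p<n. class_size c n p / (y - class_size c n p)))"
proof -
  let ?m = "\<lambda>p. real (class_size c n p)"
  \<comment> \<open>Here F = - (J + I) E^T / y. As every label is below n, each row of
    \<open>E\<close> has exactly one entry 1.\<close>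
  define E where "E = mat n n (\<lambda>(i, p). if c i = p then 1 else (0::real))"
  define F where "F = mat n n (\<lambda>(p, j). - (1 + (if c j = p then 1 else 0)) / y)"
  have E: "E \<in> carrier_mat n n" and F: "F \<in> carrier_mat n n"
    by (auto simp: E_def F_def)
  have "(y - 2) \<cdot>\<^sub>m 1\<^sub>m n - multipartite_dist_mat c n = y \<cdot>\<^sub>m (1\<^sub>m n + E * F)"
  proof (intro eq_matI)
    fix i j assume "i < dim_row (y \<cdot>\<^sub>m (1\<^sub>m n + E * F))" "j < dim_col (y \<cdot>\<^sub>m (1\<^sub>m n + E * F))"
    then have ij: "i < n" "j < n" using E F by auto
    have "(E * F) $$ (i, j) = (\<Sum>p<n. E $$ (i, p) * F $$ (p, j))"
      using ij E F by (auto simp: scalar_prod_def lessThan_atLeast0 intro!: sum.cong)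
    also have "\<dots> = (\<Sum>p<n. if c i = p then F $$ (p, j) else 0)"
      using ij by (intro sum.cong) (simp_all add: E_def)
    also have "\<dots> = - (1 + (if c i = c j then 1 else 0)) / y"
      using ij c[OF ij(1)] by (auto simp: F_def)
    finally show "((y - 2) \<cdot>\<^sub>m 1\<^sub>m n - multipartite_dist_mat c n) $$ (i, j) = (y \<cdot>\<^sub>m (1\<^sub>m n + E * F)) $$ (i, j)"
      using ij y(1) E F by (auto simp: multipartite_dist_mat_def algebra_simps)
  qed (use E F in \<open>auto simp: multipartite_dist_mat_def\<close>)
  then have "poly (char_poly (multipartite_dist_mat c n)) (y - 2) = y ^ n * det (1\<^sub>m n + E * F)"
    using E F by (simp add: poly_char_poly[of _ n])
  also have "det (1\<^sub>m n + E * F) = det (1\<^sub>m n + F * E)"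
    by (rule det_one_add_mult_commute[OF E F])
  \<comment> \<open>The left side is I - M/y - J M/y; taking I - M/y out on the right leaves I - J M
    (y I - M)^-1, which exists because y is not a class size.\<close>
  also have "1\<^sub>m n + F * E =
      mat n n (\<lambda>(i, j). (if i = j then 1 else 0) + 1 * (- ?m j / (y - ?m j))) * mat_diag n (\<lambda>p. 1 - ?m p / y)"
    (is "_ = ?R * ?Diag")
  proof (intro eq_matI)
    fix p q assume "p < dim_row (?R * ?Diag)" "q < dim_col (?R * ?Diag)"
    then have pq: "p < n" "q < n" by (auto simp: mat_diag_def)
    have "(F * E) $$ (p, q) = (\<Sum>j<n. F $$ (p, j) * E $$ (j, q))"
      using pq E F by (auto simp: scalar_prod_def lessThan_atLeast0 intro!: sum.cong)
    also have "\<dots> = (\<Sum>j<n. if c j = q then F $$ (p, j) else 0)"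
      using pq by (intro sum.cong) (simp_all add: E_def)
    also have "\<dots> = (\<Sum>j\<in>{j. j < n \<and> c j = q}. - (1 + (if p = q then 1 else 0)) / y)"
      by (subst sum.inter_filter[symmetric])
        (use pq in \<open>auto simp: F_def intro!: sum.cong\<close>)
    also have "\<dots> = - (1 + (if p = q then 1 else 0)) * ?m q / y"
      by (simp add: class_size_def)
    finally have FE: "(F * E) $$ (p, q) = - (1 + (if p = q then 1 else 0)) * ?m q / y" .
    have "(?R * ?Diag) $$ (p, q) = ((if p = q then 1 else 0) - ?m q / (y - ?m q)) * (1 - ?m q / y)"
      using pq by (subst mat_diag_mult_right[of _ n]) (auto simp: mult.commute)
    also have "\<dots> = (if p = q then 1 else 0) + (F * E) $$ (p, q)"
      using y(1) y(2)[OF pq(2)] unfolding FE by (auto simp: field_simps)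
    finally show "(1\<^sub>m n + F * E) $$ (p, q) = (?R * ?Diag) $$ (p, q)"
      using pq E F by simp
  qed (use E F in \<open>auto simp: mat_diag_def\<close>)
  also have "det \<dots> = (1 - (\<Sum>p<n. ?m p / (y - ?m p))) * (\<Prod>p<n. 1 - ?m p / y)"
  proof -
    have "det ?R = 1 - (\<Sum>p<n. ?m p / (y - ?m p))"
      by (subst det_one_add_outer) (simp add: sum_negf)
    then show ?thesis
      by (subst det_mult[of _ n]) (simp_all only: mat_carrier mat_diag_dim det_mat_diag)
  qed
  also have "y ^ n * ((1 - (\<Sum>p<n. ?m p / (y - ?m p))) * (\<Prod>p<n. 1 - ?m p / y)) =
     (\<Prod>p<n. y * (1 - ?m p / y)) * (1 - (\<Sum>p<n. ?m p / (y - ?m p)))"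
    by (subst prod.distrib) simp
  also have "(\<Prod>p<n. y * (1 - ?m p / y)) = (\<Prod>p<n. y - ?m p)"
    using y(1) by (intro prod.cong) (auto simp: field_simps)
  finally show ?thesis .
qed

text \<open>The map from p to (n + 1) p - X p' multiplies the coefficient of X^i by n + 1 - i, which
  is nonzero for i up to n.\<close>

lemma pCons_pderiv_determines:
  fixes p q :: "'a :: {idom, ring_char_0} poly"
  assumes "degree p \<le> n" "degree q \<le> n"
    and eq: "Polynomial.smult (of_nat (Suc n)) p - pCons 0 (pderiv p) =
      Polynomial.smult (of_nat (Suc n)) q - pCons 0 (pderiv q)"
  shows "p = q"
proof (rule poly_eqI)
  fix i
  have coeff: "coeff (Polynomial.smult (of_nat (Suc n)) r - pCons 0 (pderiv r)) i =
      (of_nat (Suc n) - of_nat i) * coeff r i"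
    for r :: "'a poly"
    by (cases i) (auto simp: coeff_pderiv algebra_simps)
  show "coeff p i = coeff q i"
  proof (cases "i \<le> n")
    case True
    then have "i \<noteq> Suc n" by simp
    then have "of_nat (Suc n) - of_nat i \<noteq> (0 :: 'a)"
      unfolding right_minus_eq of_nat_eq_iff by simp
    moreover have "(of_nat (Suc n) - of_nat i) * coeff p i = (of_nat (Suc n) - of_nat i) * coeff q i"
      using arg_cong[OF eq, of "\<lambda>r. coeff r i"] unfolding coeff .
    ultimately show ?thesis by (rule mult_left_cancel[THEN iffD1])
  qed (use assms in \<open>simp add: coeff_eq_0\<close>)
qed

text \<open>The logarithmic derivative of a product of linear factors, cleared of its
  denominator.\<close>

lemma poly_pderiv_prod_linear:
  fixes a :: "'b \<Rightarrow> 'a :: field_char_0"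
  assumes "finite S" and ne: "\<And>p. p \<in> S \<Longrightarrow> y \<noteq> a p"
  shows "poly (pderiv (\<Prod>p\<in>S. [:- a p, 1:])) y = (\<Prod>p\<in>S. y - a p) * (\<Sum>p\<in>S. 1 / (y - a p))"
proof -
  have remove: "(\<Prod>q\<in>S - {p}. y - a q) = (\<Prod>q\<in>S. y - a q) / (y - a p)" if "p \<in> S" for p
    using assms that by (subst prod.remove[of S p]) auto
  have "poly (pderiv (\<Prod>p\<in>S. [:- a p, 1:])) y = (\<Sum>p\<in>S. \<Prod>q\<in>S - {p}. y - a q)"
    by (simp add: pderiv_prod poly_sum poly_prod pderiv_pCons)
  also have "\<dots> = (\<Sum>p\<in>S. (\<Prod>q\<in>S. y - a q) * (1 / (y - a p)))"
    by (intro sum.cong) (simp_all add: remove)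
  finally show ?thesis by (simp only: sum_distrib_left)
qed

text \<open>Since m / (y - m) = y / (y - m) - 1, the factor 1 - sum m / (y - m) equals n + 1 - y
  q'(y) / q(y). Multiplying by q(y) gives the identity at all but finitely many y, hence for
  polynomials.\<close>

lemma char_poly_multipartite:
  fixes c :: "nat \<Rightarrow> nat" and n :: nat
  defines "q \<equiv> \<Prod>p<n. [:- real (class_size c n p), 1:]"
  assumes c: "\<And>i. i < n \<Longrightarrow> c i < n"
  shows "pcompose (char_poly (multipartite_dist_mat c n)) [:-2, 1:] =
    Polynomial.smult (of_nat (Suc n)) q - pCons 0 (pderiv q)" (is "?l = ?r")
proof -
  let ?m = "\<lambda>p. real (class_size c n p)"
  have eq: "poly (?l - ?r) y = 0" if "y \<notin> insert 0 (?m ` {..<n})" for y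
  proof -
    have y: "y \<noteq> 0" "\<And>p. p < n \<Longrightarrow> y \<noteq> ?m p"
      using that by auto
    have "poly ?l y = (\<Prod>p<n. y - ?m p) * (1 - (\<Sum>p<n. ?m p / (y - ?m p)))"
      using poly_char_poly_multipartite[OF c y] by (simp add: poly_pcompose)
    also have "(\<Sum>p<n. ?m p / (y - ?m p)) = (\<Sum>p<n. y * (1 / (y - ?m p)) - 1)"
      using y by (intro sum.cong) (auto simp: field_simps)
    also have "\<dots> = y * (\<Sum>p<n. 1 / (y - ?m p)) - n"
      by (simp add: sum_subtractf sum_distrib_left)
    also have "(\<Prod>p<n. y - ?m p) * (1 - \<dots>) = poly ?r y"
      using poly_pderiv_prod_linear[of "{..<n}" y ?m] y(2) by (simp add: q_def poly_prod algebra_simps)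
    finally show ?thesis by simp
  qed
  have "infinite (UNIV - insert 0 (?m ` {..<n}))"
    by (simp add: infinite_UNIV_char_0)
  then have "infinite {y. poly (?l - ?r) y = 0}"
    by (rule infinite_super[rotated]) (use eq in blast)
  then have "?l - ?r = 0"
    using poly_roots_finite by blast
  then show ?thesis by simp
qed

lemma sum_single_image_mset:
  "finite S \<Longrightarrow> (\<Sum>p\<in>S. {#f p#}) = image_mset f (mset_set S)"
  by (induction S rule: finite_induct) auto

text \<open>The class sizes are the roots of q with multiplicity, and the characteristic polynomial
  determines q. Empty labels give the root 0, so q has degree n for every labelling, as the recovery
  of q requires.\<close>

lemma char_poly_multipartite_determines_class_sizes:
  assumes c: "\<And>i. i < n \<Longrightarrow> c i < n" and c': "\<And>i. i < n \<Longrightarrow> c' i < n"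
    and eq: "char_poly (multipartite_dist_mat c n) = char_poly (multipartite_dist_mat c' n)"
  shows "image_mset (class_size c n) (mset_set {..<n}) = image_mset (class_size c' n) (mset_set {..<n})"
proof -
  let ?q = "\<lambda>c. \<Prod>p<n. [:- real (class_size c n p), 1:]"
  have degree: "degree (?q c) = n" for c
    by (subst degree_prod_eq_sum_degree) auto
  have q: "?q c = ?q c'"
  proof (rule pCons_pderiv_determines)
    show "Polynomial.smult (of_nat (Suc n)) (?q c) - pCons 0 (pderiv (?q c)) =
        Polynomial.smult (of_nat (Suc n)) (?q c') - pCons 0 (pderiv (?q c'))"
      using arg_cong[OF eq, of "\<lambda>p. pcompose p [:-2, 1:]"]
      by (simp only: char_poly_multipartite c c')
  qed (simp_all only: degree order_refl)
  have roots: "proots (?q c) = image_mset real (image_mset (class_size c n) (mset_set {..<n}))" for c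
  proof -
    have "proots (?q c) = (\<Sum>p<n. proots [:- real (class_size c n p), 1:])"
      by (rule proots_prod) simp
    also have "\<dots> = (\<Sum>p<n. {#real (class_size c n p)#})"
      by (simp only: proots_linear_factor minus_minus)
    also have "\<dots> = image_mset (\<lambda>p. real (class_size c n p)) (mset_set {..<n})"
      by (rule sum_single_image_mset) simp
    finally show ?thesis by (simp only: multiset.map_comp comp_def)
  qed
  have "image_mset real (image_mset (class_size c n) (mset_set {..<n})) =
      image_mset real (image_mset (class_size c' n) (mset_set {..<n}))"
    using arg_cong[OF q, of proots] unfolding roots .
  then show ?thesis
    by (rule multiset.inj_map_strong[rotated]) simp
qed

text \<open>For y = x + 2 < 0 every y - m is negative. So the product does not vanish, and the
  subtracted sum is at most 0, which makes the other factor at least 1.\<close>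

lemma poly_char_poly_multipartite_neg:
  assumes c: "\<And>i. i < n \<Longrightarrow> c i < n" and x: "x < - 2"
  shows "poly (char_poly (multipartite_dist_mat c n)) x \<noteq> 0"
proof -
  let ?m = "\<lambda>p. real (class_size c n p)"
  have y: "x + 2 < 0" using x by simp
  have "poly (char_poly (multipartite_dist_mat c n)) (x + 2 - 2) =
    (\<Prod>p<n. x + 2 - ?m p) * (1 - (\<Sum>p<n. ?m p / (x + 2 - ?m p)))"
    using y by (intro poly_char_poly_multipartite c) auto
  moreover have "(\<Prod>p<n. x + 2 - ?m p) \<noteq> 0"
    using y by (auto simp: prod_zero_iff)
  moreover have "(\<Sum>p<n. ?m p / (x + 2 - ?m p)) \<le> 0"
    using y by (intro sum_nonpos divide_nonneg_nonpos) auto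
  ultimately show ?thesis by simp
qed

text \<open>Equal multisets of sizes give a permutation of the labels that preserves size;
  bijections between corresponding classes are then glued together.\<close>

lemma bij_betw_preserving_classes:
  assumes c: "\<And>i. i < n \<Longrightarrow> c i < n" and c': "\<And>i. i < n \<Longrightarrow> c' i < n"
    and eq: "image_mset (class_size c n) (mset_set {..<n}) = image_mset (class_size c' n) (mset_set {..<n})"
  obtains f where "bij_betw f {..<n} {..<n}"
    and "\<And>i j. i < n \<Longrightarrow> j < n \<Longrightarrow> c' (f i) = c' (f j) \<longleftrightarrow> c i = c j"
proof -
  obtain \<pi> where \<pi>: "\<pi> permutes {..<n}" "\<forall>p\<in>{..<n}. class_size c n p = class_size c' n (\<pi> p)"
    by (rule image_mset_eq_implies_permutes[OF finite_lessThan eq])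
  have "\<exists>g. bij_betw g {i. i < n \<and> c i = p} {i. i < n \<and> c' i = \<pi> p}" if "p < n" for p
    using \<pi>(2) that unfolding class_size_def by (intro finite_same_card_bij) auto
  then obtain g where g: "\<And>p. p < n \<Longrightarrow> bij_betw (g p) {i. i < n \<and> c i = p} {i. i < n \<and> c' i = \<pi> p}"
    by metis
  define f where "f i = g (c i) i" for i
  have f: "f i < n" "c' (f i) = \<pi> (c i)" if "i < n" for i
    using bij_betwE[OF g[OF c[OF that]]] that by (auto simp: f_def)
  have same: "c' (f i) = c' (f j) \<longleftrightarrow> c i = c j" if "i < n" "j < n" for i j
    using f(2)[OF that(1)] f(2)[OF that(2)] permutes_inj[OF \<pi>(1)] by (metis injD)
  have "inj_on f {..<n}"
  proof (rule inj_onI)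
    fix i j assume ij: "i \<in> {..<n}" "j \<in> {..<n}" and fij: "f i = f j"
    then have "c i = c j" using same[of i j] by simp
    with ij fij bij_betw_imp_inj_on[OF g[OF c[of i]]] show "i = j"
      by (auto simp: f_def dest: inj_onD)
  qed
  moreover from this have "f ` {..<n} = {..<n}"
    using f(1) by (intro endo_inj_surj) auto
  ultimately show thesis
    using same that by (auto simp: bij_betw_def)
qed

section \<open>Distances in a connected graph\<close>

context pair_graph
begin

lemma sym_parcs: "(u, v) \<in> parcs G \<Longrightarrow> (v, u) \<in> parcs G"
  using pair_sym_arcs by (auto simp: symmetric_def dest: symD)

lemma graph_dist_le: "apath u p v \<Longrightarrow> graph_dist G u v \<le> length p"
  unfolding graph_dist_def by (rule Least_le) blast

text \<open>Both conclusions share one induction: appending an arc extends the vertex list as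
  expected only if the walk so far ends at the tail of that arc.\<close>

lemma pawalk_verts_reverse:
  "pcas u p v \<Longrightarrow> pcas v (rev (map prod.swap p)) u \<and>
    pawalk_verts v (rev (map prod.swap p)) = rev (pawalk_verts u p)"
proof (induction p arbitrary: u)
  case (Cons e p)
  have app: "pcas x (p1 @ [e']) z \<longleftrightarrow> pcas x p1 (fst e') \<and> z = snd e'"
    "pcas x p1 (fst e') \<Longrightarrow> pawalk_verts x (p1 @ [e']) = pawalk_verts x p1 @ [snd e']" for x p1 e' z
    by (induction p1 arbitrary: x) auto
  show ?case
    using Cons.IH[of "snd e"] Cons.prems by (auto simp: app)
qed auto

lemma apath_reverse: "apath u p v \<Longrightarrow> apath v (rev (map prod.swap p)) u"
  using pawalk_verts_reverse[of u p v] awalk_last_in_verts[of u p v]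
  by (auto simp: apath_def awalk_def intro: sym_parcs)

lemma graph_dist_commute: "graph_dist G u v = graph_dist G v u"
proof -
  have "(\<exists>p. apath u p v \<and> length p = d) \<longleftrightarrow> (\<exists>p. apath v p u \<and> length p = d)" for d
    using apath_reverse by (metis length_map length_rev)
  then show ?thesis by (simp add: graph_dist_def)
qed

end

locale connected_pair_graph = pair_graph +
  assumes conn: "Digraph_Component.connected (with_proj G)"
begin

lemma apath_exists:
  assumes "u \<in> pverts G" "v \<in> pverts G"
  shows "\<exists>p. apath u p v"
  using symmetric_connected_imp_strongly_connected[OF sym_arcs conn] assms
  by (auto simp: strongly_connected_def reachable_apath)

text \<open>Connectedness makes the set under \<open>LEAST\<close> nonempty, so the distance is the
  length of an actual path.\<close>

lemma graph_dist_attained: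
  assumes "u \<in> pverts G" "v \<in> pverts G"
  obtains p where "apath u p v" "length p = graph_dist G u v"
proof -
  have "\<exists>d p. apath u p v \<and> length p = d" using apath_exists[OF assms] by blast
  from LeastI_ex[OF this] show thesis
    using that by (auto simp: graph_dist_def)
qed

lemma graph_dist_eq_0_iff:
  assumes "u \<in> pverts G" "v \<in> pverts G"
  shows "graph_dist G u v = 0 \<longleftrightarrow> u = v"
proof
  show "u = v" if "graph_dist G u v = 0"
    using graph_dist_attained[OF assms] that by (metis apath_Nil_iff length_0_conv)
  show "graph_dist G u v = 0" if "u = v"
    using graph_dist_le[of u "[]" v] assms that by (simp add: apath_Nil_iff)
qed

lemma graph_dist_eq_1_iff:
  assumes "u \<in> pverts G" "v \<in> pverts G"
  shows "graph_dist G u v = 1 \<longleftrightarrow> (u, v) \<in> parcs G"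
proof
  assume "graph_dist G u v = 1"
  then obtain p where p: "apath u p v" "length p = 1"
    using graph_dist_attained[OF assms] by metis
  then obtain e where "p = [e]" by (cases p) auto
  with p(1) show "(u, v) \<in> parcs G"
    by (cases e) (auto simp: apath_simps)
next
  assume uv: "(u, v) \<in> parcs G"
  then have "u \<noteq> v" using pair_no_loops by force
  then have "apath u [(u, v)] v"
    using uv assms by (auto simp: apath_simps)
  from graph_dist_le[OF this] have "graph_dist G u v \<le> 1" by simp
  moreover have "graph_dist G u v \<noteq> 0"
    using graph_dist_eq_0_iff[OF assms] \<open>u \<noteq> v\<close> by simp
  ultimately show "graph_dist G u v = 1" by linarith
qed

lemma graph_dist_if_nonadjacency_transitive:
  assumes tr: "\<And>u v w. u \<in> pverts G \<Longrightarrow> v \<in> pverts G \<Longrightarrow> w \<in> pverts G \<Longrightarrow>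
      (u, v) \<notin> parcs G \<Longrightarrow> (v, w) \<notin> parcs G \<Longrightarrow> (u, w) \<notin> parcs G"
    and uv: "u \<in> pverts G" "v \<in> pverts G"
  shows "graph_dist G u v = (if u = v then 0 else if (u, v) \<in> parcs G then 1 else 2)"
proof (cases "u = v \<or> (u, v) \<in> parcs G")
  case True
  then show ?thesis
    using graph_dist_eq_0_iff[OF uv] graph_dist_eq_1_iff[OF uv] by auto
next
  case False
  obtain p where p: "apath u p v" using apath_exists[OF uv] by blast
  then obtain w where uw: "(u, w) \<in> parcs G"
    using False by (cases p) (auto simp: apath_simps)
  have w: "w \<in> pverts G" using uw by (rule in_arcsD2)
  \<comment> \<open>Otherwise u, v and v, w would be nonadjacent pairs, and transitivity would
    contradict the arc from u to w. So the first step of any path from u already leads to a common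
    neighbour.\<close>
  have wv: "(w, v) \<in> parcs G"
    using tr[OF uv w] uw False sym_parcs by metis
  have "u \<noteq> w" "w \<noteq> v" using uw wv pair_no_loops by force+
  then have "apath u [(u, w), (w, v)] v"
    using uv w uw wv False by (auto simp: apath_simps)
  from graph_dist_le[OF this] have "graph_dist G u v \<le> 2" by simp
  moreover have "graph_dist G u v \<noteq> 0" "graph_dist G u v \<noteq> 1"
    using graph_dist_eq_0_iff[OF uv] graph_dist_eq_1_iff[OF uv] False by auto
  ultimately show ?thesis using False by simp
qed

text \<open>Nonadjacency is an equivalence relation, reflexive because there are no loops. The least
  index in the class of a vertex serves as its label, which is automatically below the number of
  vertices.\<close>

lemma distance_matrix_multipartite:
  assumes tr: "\<And>u v w. u \<in> pverts G \<Longrightarrow> v \<in> pverts G \<Longrightarrow> w \<in> pverts G \<Longrightarrow>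
      (u, v) \<notin> parcs G \<Longrightarrow> (v, w) \<notin> parcs G \<Longrightarrow> (u, w) \<notin> parcs G"
    and vs: "distinct vs" "set vs = pverts G"
  obtains c where "\<And>i. i < length vs \<Longrightarrow> c i < length vs"
    and "\<And>i j. i < length vs \<Longrightarrow> j < length vs \<Longrightarrow> (vs ! i, vs ! j) \<in> parcs G \<longleftrightarrow> c i \<noteq> c j"
    and "distance_matrix G vs = multipartite_dist_mat c (length vs)"
proof -
  let ?n = "length vs"
  define P where "P i j \<longleftrightarrow> j < ?n \<and> (vs ! i, vs ! j) \<notin> parcs G" for i j
  define c where "c i = (LEAST j. P i j)" for i
  have V: "vs ! i \<in> pverts G" if "i < ?n" for i
    using nth_mem[OF that] unfolding vs(2) .
  have refl: "P i i" if "i < ?n" for i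
    using that pair_no_loops by (force simp: P_def)
  have cP: "P i (c i)" if "i < ?n" for i
    unfolding c_def using refl[OF that] by (rule LeastI)
  have less: "c i < ?n" if "i < ?n" for i
    using cP[OF that] by (simp add: P_def)
  have adj: "(vs ! i, vs ! j) \<in> parcs G \<longleftrightarrow> c i \<noteq> c j" if ij: "i < ?n" "j < ?n" for i j
  proof
    assume "(vs ! i, vs ! j) \<in> parcs G"
    then show "c i \<noteq> c j"
      using cP[OF ij(1)] cP[OF ij(2)] tr[OF V[OF ij(1)] V[OF less[OF ij(1)]] V[OF ij(2)]]
        sym_parcs[of "vs ! c i" "vs ! j"]
      unfolding P_def by metis
  next
    assume "c i \<noteq> c j"
    show "(vs ! i, vs ! j) \<in> parcs G"
    proof (rule ccontr)
      assume nadj: "(vs ! i, vs ! j) \<notin> parcs G"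
      have "(vs ! j, vs ! i) \<notin> parcs G" using nadj sym_parcs[of "vs ! j" "vs ! i"] by blast
      with nadj have "P i k \<longleftrightarrow> P j k" for k
        using tr[OF V[OF ij(1)] V[OF ij(2)], of "vs ! k"] tr[OF V[OF ij(2)] V[OF ij(1)], of "vs ! k"] V[of k]
        unfolding P_def by blast
      then have "c i = c j" by (simp add: c_def)
      with \<open>c i \<noteq> c j\<close> show False by simp
    qed
  qed
  have "graph_dist G (vs ! i) (vs ! j) = (if i = j then 0 else if c i = c j then 2 else 1)"
    if ij: "i < ?n" "j < ?n" for i j
    using graph_dist_if_nonadjacency_transitive[OF tr V[OF ij(1)] V[OF ij(2)]] adj[OF ij]
      nth_eq_iff_index_eq[OF vs(1) ij] by auto
  then have "distance_matrix G vs = multipartite_dist_mat c ?n"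
    unfolding distance_matrix_def multipartite_dist_mat_def by (intro cong_mat) auto
  with less adj show thesis by (rule that)
qed

lemma nonadjacency_transitive:
  assumes vs: "distinct vs" "set vs = pverts G"
    and form: "\<And>v. v \<in> carrier_vec (length vs) \<Longrightarrow> - 2 * (v \<bullet> v) \<le> v \<bullet> (distance_matrix G vs *\<^sub>v v)"
    and uvw: "u \<in> pverts G" "v \<in> pverts G" "w \<in> pverts G"
    and uv: "(u, v) \<notin> parcs G" and vw: "(v, w) \<notin> parcs G"
  shows "(u, w) \<notin> parcs G"
proof
  assume uw: "(u, w) \<in> parcs G"
  let ?D = "distance_matrix G vs" and ?n = "length vs"
  have D: "?D \<in> carrier_mat ?n ?n" by (simp add: distance_matrix_def)
  have form': "- 2 * (\<Sum>i\<in>S. x i * x i) \<le> (\<Sum>i\<in>S. \<Sum>j\<in>S. x i * ?D $$ (i, j) * x j)"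
    if "S \<subseteq> {..<?n}" for S x
    using form[of "vec ?n (\<lambda>i. if i \<in> S then x i else 0)"]
    unfolding quadratic_form_on_support[OF D that] scalar_prod_on_support[OF that] by simp
  have d: "?D $$ (i, j) = graph_dist G (vs ! i) (vs ! j)" if "i < ?n" "j < ?n" for i j
    using that by (simp add: distance_matrix_def)
  have d0: "graph_dist G x x = 0" if "x \<in> pverts G" for x
    using graph_dist_eq_0_iff[OF that that] by simp
  \<comment> \<open>The test vector (1, -1) gives -4 \<le> -2 d(x, y); distances 0 and 1 are
    excluded by the assumptions on x and y.\<close>
  have dist2: "graph_dist G x y = 2" if xy: "x \<in> pverts G" "y \<in> pverts G" "x \<noteq> y" "(x, y) \<notin> parcs G" for x y
  proof -
    obtain i j where ij: "i < ?n" "vs ! i = x" "j < ?n" "vs ! j = y"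
      using xy(1,2) unfolding vs(2)[symmetric] in_set_conv_nth by blast
    with xy have "i \<noteq> j" by auto
    then have "- 4 \<le> real (graph_dist G x x) - graph_dist G x y - graph_dist G y x + graph_dist G y y"
      using form'[of "{i, j}" "\<lambda>k. if k = i then 1 else -1"] ij(1,3)
      by (simp add: d ij(2,4))
    then have "real (graph_dist G x y) \<le> 2"
      using xy by (simp add: graph_dist_commute[of y x] d0)
    moreover have "graph_dist G x y \<noteq> 0" "graph_dist G x y \<noteq> 1"
      using graph_dist_eq_0_iff[OF xy(1,2)] graph_dist_eq_1_iff[OF xy(1,2)] xy by auto
    ultimately show ?thesis by linarith
  qed
  have ne: "u \<noteq> v" "v \<noteq> w" "u \<noteq> w"
    using uv vw uw sym_parcs[OF uw] pair_no_loops[OF uw] by auto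
  obtain i j k where ijk: "i < ?n" "vs ! i = u" "j < ?n" "vs ! j = v" "k < ?n" "vs ! k = w"
    using uvw unfolding vs(2)[symmetric] in_set_conv_nth by blast
  with ne have ne': "i \<noteq> j" "j \<noteq> k" "i \<noteq> k" by auto
  have dist: "graph_dist G u v = 2" "graph_dist G v w = 2" "graph_dist G u w = 1"
    using dist2 ne uvw uv vw uw graph_dist_eq_1_iff by auto
  \<comment> \<open>The test vector is (1, -2, 1) on u, v, w, of squared norm 6. With distances 2,
    2, 1 the right side is 2 - 8 - 8 = -14.\<close>
  have "- 12 \<le> real (graph_dist G u u) - 2 * graph_dist G u v + graph_dist G u w
      - 2 * graph_dist G v u + 4 * graph_dist G v v - 2 * graph_dist G v w
      + graph_dist G w u - 2 * graph_dist G w v + graph_dist G w w"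
    using form'[of "{i, j, k}" "\<lambda>l. if l = j then -2 else 1"] ne' ne'[symmetric] ijk(1,3,5)
    by (simp add: d ijk(2,4,6))
  then show False
    using uvw by (simp add: graph_dist_commute[of v u] graph_dist_commute[of w v]
        graph_dist_commute[of w u] d0 dist)
qed

end

section \<open>Cospectral graphs\<close>

lemma of_real_char_poly_distance_matrix:
  "map_poly complex_of_real (char_poly (distance_matrix G (vertex_enum G))) =
    (\<Prod>x\<in>#D_spectrum G. [:- x, 1:])"
proof -
  let ?D = "distance_matrix G (vertex_enum G)"
  let ?p = "char_poly (map_mat complex_of_real ?D)"
  have D: "?D \<in> carrier_mat (length (vertex_enum G)) (length (vertex_enum G))"
    by (simp add: distance_matrix_def)
  then have "map_mat complex_of_real ?D \<in> carrier_mat (length (vertex_enum G)) (length (vertex_enum G))"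
    by simp
  from degree_monic_char_poly[OF this] have "lead_coeff ?p = 1" by simp
  then have "(\<Prod>x\<in>#proots ?p. [:- x, 1:]) = ?p"
    using complex_poly_decompose_multiset[of ?p] by simp
  then show ?thesis
    by (simp add: D_spectrum_def of_real_hom.char_poly_hom[OF D])
qed

text \<open>Over the complex numbers a monic polynomial is the product over its multiset of roots;
  equality descends to the real coefficients because the embedding is injective.\<close>

lemma char_poly_eq_if_D_spectrum_eq:
  assumes "D_spectrum G = D_spectrum H"
  shows "char_poly (distance_matrix G (vertex_enum G)) = char_poly (distance_matrix H (vertex_enum H))"
    (is "?p = ?q")
proof (rule poly_eqI)
  fix i
  have "map_poly complex_of_real ?p = map_poly complex_of_real ?q"
    unfolding of_real_char_poly_distance_matrix assms ..
  from arg_cong[OF this, of "\<lambda>p. coeff p i"] show "coeff ?p i = coeff ?q i"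
    by (simp add: coeff_map_poly)
qed

text \<open>Arcs are pairs of vertices, so the vertex bijection forces the arc map
  \<open>map_prod h h\<close>; adjacency in both directions makes its image exactly the arcs of
  \<open>H\<close>.\<close>

lemma digraph_isoI_bij:
  assumes G: "pair_wf_digraph G" and H: "pair_wf_digraph H"
    and h: "bij_betw h (pverts G) (pverts H)"
    and adj: "\<And>u v. u \<in> pverts G \<Longrightarrow> v \<in> pverts G \<Longrightarrow> (h u, h v) \<in> parcs H \<longleftrightarrow> (u, v) \<in> parcs G"
  shows "digraph_iso (with_proj G) (with_proj H)"
proof -
  interpret G: pair_wf_digraph G by fact
  interpret H: pair_wf_digraph H by fact
  let ?h = "\<lparr>iso_verts = h, iso_arcs = map_prod h h, iso_head = snd, iso_tail = fst\<rparr>"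
  have sub: "parcs G \<subseteq> pverts G \<times> pverts G" "parcs H \<subseteq> pverts H \<times> pverts H"
    using G.wellformed' H.wellformed' by auto
  have inj: "inj_on h (pverts G)" and surj: "h ` pverts G = pverts H"
    using h by (auto simp: bij_betw_def)
  have arcs: "map_prod h h ` parcs G = parcs H"
  proof
    show "map_prod h h ` parcs G \<subseteq> parcs H"
      using sub(1) adj by auto
    show "parcs H \<subseteq> map_prod h h ` parcs G"
    proof
      fix e assume e: "e \<in> parcs H"
      then have "e \<in> (h ` pverts G) \<times> (h ` pverts G)" using sub(2) surj by blast
      then obtain u v where uv: "u \<in> pverts G" "v \<in> pverts G" "e = (h u, h v)" by blast
      with e adj have "(u, v) \<in> parcs G" by blast
      with uv(3) show "e \<in> map_prod h h ` parcs G" by force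
    qed
  qed
  have "inj_on (map_prod h h) (parcs G)"
    using map_prod_inj_on[OF inj inj] sub(1) by (rule inj_on_subset)
  then have "pre_digraph.digraph_isomorphism (with_proj G) ?h"
    using inj G.wf_digraph by (auto simp: pre_digraph.digraph_isomorphism_def)
  moreover have "with_proj H = app_iso ?h (with_proj G)"
    by (simp add: app_iso_def with_proj_def surj arcs)
  ultimately show ?thesis unfolding digraph_iso_def by blast
qed

theorem theorem2p8:
  fixes k n :: nat
    and ns :: "nat \<Rightarrow> nat"
    and G' :: "'v pair_pre_digraph"
  assumes "k \<ge> 2"
    and "\<forall>i\<in>{1..k}. ns i > 0"
    and "(\<Sum>i=1..k. ns i) = n"
    and "pair_graph G'"
    and "Digraph_Component.connected (with_proj G')"
    and "D_spectrum G' = D_spectrum (complete_multipartite k ns)"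
  shows "digraph_iso (with_proj G') (with_proj (complete_multipartite k ns))"
proof -
  let ?G = "complete_multipartite k ns"
  define vs where "vs = vertex_enum ?G"
  define vs' where "vs' = vertex_enum G'"
  have pg: "pair_graph ?G" by (rule pair_graph_complete_multipartite)
  interpret G: connected_pair_graph ?G
    using pg connected_complete_multipartite[OF assms(1,2)]
    by (simp add: connected_pair_graph_def connected_pair_graph_axioms_def)
  interpret G': connected_pair_graph G'
    using assms(4,5) by (simp add: connected_pair_graph_def connected_pair_graph_axioms_def)
  note vs = vertex_enum[OF pg, folded vs_def]
  note vs' = vertex_enum[OF assms(4), folded vs'_def]
  have len: "length vs' = length vs"
    using size_D_spectrum[OF assms(4)] size_D_spectrum[OF pg] assms(6) distinct_card[OF vs(1)]
      distinct_card[OF vs'(1)] vs(2) vs'(2) by simp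
  have cp: "char_poly (distance_matrix G' vs') = char_poly (distance_matrix ?G vs)"
    using char_poly_eq_if_D_spectrum_eq[OF assms(6)] unfolding vs_def vs'_def .
  \<comment> \<open>In \<open>?G\<close> two vertices are nonadjacent exactly when their first
    components agree, so nonadjacency is transitive.\<close>
  obtain c where c: "\<And>i. i < length vs \<Longrightarrow> c i < length vs"
    and adj: "\<And>i j. i < length vs \<Longrightarrow> j < length vs \<Longrightarrow> (vs ! i, vs ! j) \<in> parcs ?G \<longleftrightarrow> c i \<noteq> c j"
    and D: "distance_matrix ?G vs = multipartite_dist_mat c (length vs)"
    by (rule G.distance_matrix_multipartite[OF _ vs])
      (auto simp: complete_multipartite_def Let_def)
  have D'_carrier: "distance_matrix G' vs' \<in> carrier_mat (length vs') (length vs')"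
    by (simp add: distance_matrix_def)
  have D'_sym: "transpose_mat (distance_matrix G' vs') = distance_matrix G' vs'"
    by (intro eq_matI) (auto simp: distance_matrix_def G'.graph_dist_commute)
  \<comment> \<open>The characteristic polynomial is that of \<open>?G\<close>, which has no root
    below -2. This is how the spectrum constrains the structure of \<open>G'\<close>.\<close>
  have "- 2 * (v \<bullet> v) \<le> v \<bullet> (distance_matrix G' vs' *\<^sub>v v)" if "v \<in> carrier_vec (length vs')" for v
    using D'_carrier D'_sym _ that
    by (rule quadratic_form_ge_if_no_char_poly_root_below)
      (simp add: cp D poly_char_poly_multipartite_neg c)
  then have tr: "(u, w) \<notin> parcs G'"
    if "u \<in> pverts G'" "v \<in> pverts G'" "w \<in> pverts G'" "(u, v) \<notin> parcs G'" "(v, w) \<notin> parcs G'" for u v w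
    using G'.nonadjacency_transitive[OF vs'] that by blast
  obtain c' where c': "\<And>i. i < length vs \<Longrightarrow> c' i < length vs"
    and adj': "\<And>i j. i < length vs \<Longrightarrow> j < length vs \<Longrightarrow> (vs' ! i, vs' ! j) \<in> parcs G' \<longleftrightarrow> c' i \<noteq> c' j"
    and D': "distance_matrix G' vs' = multipartite_dist_mat c' (length vs)"
    by (rule G'.distance_matrix_multipartite[OF _ vs', unfolded len]) (erule (4) tr, auto)
  have sizes: "image_mset (class_size c' (length vs)) (mset_set {..<length vs}) =
      image_mset (class_size c (length vs)) (mset_set {..<length vs})"
    by (rule char_poly_multipartite_determines_class_sizes) (simp_all add: c c' cp flip: D D')
  obtain f where f: "bij_betw f {..<length vs} {..<length vs}"
    and same: "\<And>i j. i < length vs \<Longrightarrow> j < length vs \<Longrightarrow> c (f i) = c (f j) \<longleftrightarrow> c' i = c' j"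
    by (rule bij_betw_preserving_classes[OF _ _ sizes]) (erule c', erule c, auto)
  \<comment> \<open>A vertex of \<open>G'\<close> is sent to its position in \<open>vs'\<close>,
    moved by \<open>f\<close>, and read off in \<open>vs\<close>.\<close>
  define h where "h = (\<lambda>i. vs ! f i) \<circ> the_inv_into {..<length vs} ((!) vs')"
  have nth': "bij_betw ((!) vs') {..<length vs} (pverts G')"
    using bij_betw_nth[OF vs'(1)] vs'(2) len by simp
  have nth: "bij_betw ((!) vs) {..<length vs} (pverts ?G)"
    using bij_betw_nth[OF vs(1)] vs(2) by simp
  have h: "bij_betw h (pverts G') (pverts ?G)"
    unfolding h_def
    using bij_betw_trans[OF bij_betw_the_inv_into[OF nth'] bij_betw_trans[OF f nth]]
    by (simp add: comp_def)
  have h_nth: "h (vs' ! i) = vs ! f i" if "i < length vs" for i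
    using that by (simp add: h_def the_inv_into_f_f[OF bij_betw_imp_inj_on[OF nth']])
  have h_adj: "(h u, h v) \<in> parcs ?G \<longleftrightarrow> (u, v) \<in> parcs G'" if uv: "u \<in> pverts G'" "v \<in> pverts G'" for u v
  proof -
    obtain i j where ij: "i < length vs" "u = vs' ! i" "j < length vs" "v = vs' ! j"
      using uv bij_betw_imp_surj_on[OF nth'] by blast
    have "f i < length vs" "f j < length vs"
      using bij_betwE[OF f] ij by auto
    then show ?thesis
      using ij by (simp add: h_nth adj adj' same)
  qed
  show ?thesis by (rule digraph_isoI_bij[OF G'.pair_wf_digraph_axioms G.pair_wf_digraph_axioms h h_adj])
qed

end
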